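(* Let $0<\mu\le L$, let $f\in\mathcal{S}^2_{\mu,L}(\mathbb{R}^n)$ with minimizer $x^\star$, and let $x_0\in\mathbb{R}^n$. For any step size $0<s\le 1/L$, the solution $X=X(t)$, $t\ge 0$, of the ODE $$\ddot X(t)+2\sqrt{\mu}\,\dot X(t)+\sqrt{s}\,\nabla^2 f(X(t))\dot X(t)+(1+\sqrt{\mu s})\nabla f(X(t))=0,\qquad X(0)=x_0,\quad \dot X(0)=-\frac{2\sqrt{s}\,\nabla f(x_0)}{1+\sqrt{\mu s}},$$ satisfies, for all $t\ge 0$, $$f(X(t))-f(x^\star)\le \frac{2\|x_0-x^\star\|^2}{s}\,\mathrm{e}^{-\frac{\sqrt{\mu}\,t}{4}}.$$
   Context: $\|\cdot\|$ is the Euclidean norm. $\mathcal{S}^2_{\mu,L}(\mathbb{R}^n)$ is the class of convex functions $f:\mathbb{R}^n\to\mathbb{R}$ whose gradient is $L$-Lipschitz ($\|\nabla f(x)-\nabla f(y)\|\le L\|x-y\|$ for all $x,y$), whose Hessian exists and is Lipschitz continuous, and which are $\mu$-strongly convex: $f(y)\ge f(x)+\langle\nabla f(x),y-x\rangle+\frac{\mu}{2}\|y-x\|^2$ for all $x,y\in\mathbb{R}^n$. The ODE is the high-resolution ODE of Nesterov's accelerated gradient method for strongly convex functions (NAG-SC). *)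

theory Defs
  imports "HOL-Analysis.Analysis"
begin

definition gradient :: "('a::real_inner \<Rightarrow> real) \<Rightarrow> 'a \<Rightarrow> 'a" where
  "gradient f x = (THE g. GDERIV f x :> g)"

definition hessian :: "(real^'n \<Rightarrow> real) \<Rightarrow> real^'n \<Rightarrow> real^'n^'n" where
  "hessian f x = jacobian (gradient f) (at x)"

(* Lipschitz continuity of the Hessian is taken with respect to the entrywise Euclidean norm of
   real^'n^'n; since the constant M is existential and matrix norms are equivalent, any other
   choice (such as the operator norm) gives the same class. *)
definition smooth_strongly_convex2 :: "real \<Rightarrow> real \<Rightarrow> (real^'n \<Rightarrow> real) set" where
  "smooth_strongly_convex2 \<mu> L =
    {f. convex_on UNIV f \<and>
        (\<forall>x. f differentiable (at x)) \<and>
        (\<forall>x y. norm (gradient f x - gradient f y) \<le> L * norm (x - y)) \<and>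
        (\<forall>x. gradient f differentiable (at x)) \<and>
        (\<exists>M. M-lipschitz_on UNIV (hessian f)) \<and>
        (\<forall>x y. f y \<ge> f x + gradient f x \<bullet> (y - x) + \<mu> / 2 * (norm (y - x))\<^sup>2)}"

(* The time interval is [0, \<infinity>), with one-sided derivatives at t = 0; V and A are the first and
   second derivatives of X. *)
definition nag_sc_ode_solution ::
  "real \<Rightarrow> real \<Rightarrow> (real^'n \<Rightarrow> real) \<Rightarrow> real^'n \<Rightarrow> (real \<Rightarrow> real^'n) \<Rightarrow> bool" where
  "nag_sc_ode_solution \<mu> s f x0 X \<longleftrightarrow>
    (\<exists>V A.
      (\<forall>t\<ge>0. (X has_vector_derivative V t) (at t within {0..})) \<and>
      (\<forall>t\<ge>0. (V has_vector_derivative A t) (at t within {0..})) \<and>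
      (\<forall>t\<ge>0. A t + (2 * sqrt \<mu>) *\<^sub>R V t + sqrt s *\<^sub>R (hessian f (X t) *v V t)
              + (1 + sqrt (\<mu> * s)) *\<^sub>R gradient f (X t) = 0) \<and>
      X 0 = x0 \<and>
      V 0 = - ((2 * sqrt s / (1 + sqrt (\<mu> * s))) *\<^sub>R gradient f x0))"

end

theory Submission imports Defs begin

text \<open>
  Write \<open>c = 1 + sqrt (\<mu> * s)\<close> and \<open>g = \<nabla>f(X)\<close>. The Lyapunov function
  \<open>E = c * (f(X) - f(x*)) + |V|^2 / 4 + |V + 2 * sqrt \<mu> * (X - x*) + sqrt s * g|^2 / 4\<close>
  is adapted to the equation: the derivative of the last vector is \<open>- c * g\<close>, so the mixed terms
  \<open>g \<bullet> V\<close> cancel in \<open>E'\<close>. Strong convexity then gives \<open>E' \<le> - (sqrt \<mu> / 4) * E\<close>. Finally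
  \<open>E(0) \<le> c * 2 * |x0 - x*|^2 / s\<close>, because \<open>f(x0) - f(x*)\<close> and \<open>|\<nabla>f(x0)|\<close> are controlled by
  \<open>L \<le> 1 / s\<close>.
\<close>

section \<open>Gradients, Hessians and first-order inequalities\<close>

text \<open>\<open>gradient\<close> is a definite description, so existence and uniqueness are both
  owed: the vector assembled from the values of the derivative on \<open>Basis\<close> represents
  it, and two representing vectors agree because the derivative is unique.\<close>

lemma has_derivative_gradient:
  fixes f :: "'a::euclidean_space \<Rightarrow> real"
  assumes "f differentiable (at x)"
  shows "(f has_derivative (\<lambda>h. gradient f x \<bullet> h)) (at x)"
proof -
  obtain f' where f': "(f has_derivative f') (at x)"
    using assms by (auto simp: differentiable_def)
  interpret linear f' using f' by (rule has_derivative_linear)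
  define g where "g = (\<Sum>b\<in>Basis. f' b *\<^sub>R b)"
  have "f' h = h \<bullet> g" for h
  proof -
    have "f' h = f' (\<Sum>b\<in>Basis. (h \<bullet> b) *\<^sub>R b)"
      by (simp add: euclidean_representation)
    also have "\<dots> = h \<bullet> g"
      by (simp add: sum scale g_def inner_sum_right mult.commute)
    finally show ?thesis .
  qed
  then have g: "GDERIV f x :> g"
    using f' unfolding gderiv_def by (metis ext)
  have "gradient f x = g"
    unfolding gradient_def
  proof (rule the_equality[where P = "\<lambda>g. GDERIV f x :> g", OF g])
    fix g' assume "GDERIV f x :> g'"
    then have "(\<lambda>h. h \<bullet> g') = (\<lambda>h. h \<bullet> g)"
      using g unfolding gderiv_def by (rule has_derivative_unique)
    then show "g' = g"
      by (metis vector_eq_rdot inner_commute)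
  qed
  with g show ?thesis
    by (simp add: gderiv_def inner_commute)
qed

lemma has_derivative_hessian:
  fixes f :: "real^'n \<Rightarrow> real"
  assumes "gradient f differentiable (at x)"
  shows "(gradient f has_derivative (\<lambda>h. hessian f x *v h)) (at x)"
  using assms by (simp add: hessian_def jacobian_works)

lemma gradient_eq_0_at_minimum:
  fixes f :: "'a::euclidean_space \<Rightarrow> real"
  assumes "f differentiable (at x)" and "\<And>y. f x \<le> f y"
  shows "gradient f x = 0"
proof -
  have "(\<lambda>h. gradient f x \<bullet> h) = (\<lambda>h. 0)"
    using has_derivative_gradient[OF assms(1)] assms(2)
    by (rule has_derivative_local_min[OF _ always_eventually, rule_format])
  then show ?thesis
    by (metis inner_eq_zero_iff)
qed

text \<open>Along the line through \<open>x\<close> in direction \<open>v\<close>, monotonicity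
  makes \<open>G (x + \<tau> *\<^sub>R v) \<bullet> v\<close> nondecreasing in
  \<open>\<tau>\<close>, and its derivative at 0 is \<open>H v \<bullet> v\<close>. With
  \<open>G\<close> the gradient, this makes the Hessian positive semidefinite.\<close>

lemma monotone_imp_derivative_nonneg:
  fixes G :: "'a::real_inner \<Rightarrow> 'a"
  assumes "(G has_derivative H) (at x)"
    and mono: "\<And>x y. (G x - G y) \<bullet> (x - y) \<ge> 0"
  shows "H v \<bullet> v \<ge> 0"
proof -
  interpret linear H using assms(1) by (rule has_derivative_linear)
  have "((\<lambda>\<tau>::real. G (x + \<tau> *\<^sub>R v)) has_derivative (\<lambda>h. H (h *\<^sub>R v))) (at 0)"
    by (rule has_derivative_compose[where g = G]) (use assms(1) in \<open>auto intro!: derivative_eq_intros\<close>)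
  from has_derivative_inner_left[OF this, of v]
  have d: "((\<lambda>\<tau>::real. G (x + \<tau> *\<^sub>R v) \<bullet> v) has_real_derivative H v \<bullet> v) (at 0)"
    by (simp add: has_field_derivative_def scale mult.commute[of _ "_ \<bullet> _"])
  have "mono_on UNIV (\<lambda>\<tau>::real. G (x + \<tau> *\<^sub>R v) \<bullet> v)"
  proof (rule mono_onI)
    fix a b :: real assume "a \<le> b"
    have "(x + b *\<^sub>R v) - (x + a *\<^sub>R v) = (b - a) *\<^sub>R v"
      by (simp add: algebra_simps)
    then have "0 \<le> (b - a) * ((G (x + b *\<^sub>R v) - G (x + a *\<^sub>R v)) \<bullet> v)"
      using mono[of "x + b *\<^sub>R v" "x + a *\<^sub>R v"] by simp
    then show "G (x + a *\<^sub>R v) \<bullet> v \<le> G (x + b *\<^sub>R v) \<bullet> v"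
      using \<open>a \<le> b\<close> by (cases "a = b") (auto simp: zero_le_mult_iff inner_diff_left)
  qed
  then show ?thesis
    by (rule mono_on_imp_deriv_nonneg[OF _ d]) auto
qed

text \<open>On the segment from \<open>z\<close> to \<open>x\<close>, Cauchy-Schwarz and the
  Lipschitz bound against the vanishing gradient at \<open>z\<close> bound the slope of
  \<open>f\<close> by \<open>L * \<tau> * (norm Y)\<^sup>2\<close>. Subtracting the matching
  quadratic, as in \<open>\<phi>\<close>, leaves a nonincreasing function.\<close>

lemma descent_from_critical_point:
  fixes f :: "'a::euclidean_space \<Rightarrow> real"
  assumes diff: "\<And>x. f differentiable (at x)"
    and lip: "\<And>x y. norm (gradient f x - gradient f y) \<le> L * norm (x - y)"
    and crit: "gradient f z = 0"
  shows "f x - f z \<le> L / 2 * (norm (x - z))\<^sup>2"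
proof -
  define Y where "Y = x - z"
  define \<phi> where "\<phi> \<tau> = f (z + \<tau> *\<^sub>R Y) - L / 2 * \<tau>\<^sup>2 * (norm Y)\<^sup>2" for \<tau> :: real
  have d: "(\<phi> has_real_derivative gradient f (z + \<tau> *\<^sub>R Y) \<bullet> Y - L * \<tau> * (norm Y)\<^sup>2) (at \<tau>)" for \<tau>
  proof -
    have "((\<lambda>\<tau>. f (z + \<tau> *\<^sub>R Y)) has_derivative
        (\<lambda>h. gradient f (z + \<tau> *\<^sub>R Y) \<bullet> (h *\<^sub>R Y))) (at \<tau>)"
      by (rule has_derivative_compose[OF _ has_derivative_gradient[OF diff]])
        (auto intro!: derivative_eq_intros)
    then have "((\<lambda>\<tau>. f (z + \<tau> *\<^sub>R Y)) has_real_derivative gradient f (z + \<tau> *\<^sub>R Y) \<bullet> Y) (at \<tau>)"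
      by (simp add: has_field_derivative_def mult.commute[of _ "_ \<bullet> _"])
    then show ?thesis
      unfolding \<phi>_def by (auto intro!: derivative_eq_intros)
  qed
  have "\<phi> 1 \<le> \<phi> 0"
  proof (rule DERIV_nonpos_imp_nonincreasing[where f = \<phi> and a = 0 and b = 1])
    fix \<tau> :: real assume \<tau>: "0 \<le> \<tau>" "\<tau> \<le> 1"
    have "gradient f (z + \<tau> *\<^sub>R Y) \<bullet> Y \<le> norm (gradient f (z + \<tau> *\<^sub>R Y)) * norm Y"
      by (rule norm_cauchy_schwarz)
    also have "norm (gradient f (z + \<tau> *\<^sub>R Y)) \<le> L * (\<tau> * norm Y)"
      using lip[of "z + \<tau> *\<^sub>R Y" z] \<tau> crit by simp
    finally have "gradient f (z + \<tau> *\<^sub>R Y) \<bullet> Y - L * \<tau> * (norm Y)\<^sup>2 \<le> 0"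
      by (simp add: power2_eq_square mult_right_mono mult.assoc)
    with d show "\<exists>y. (\<phi> has_real_derivative y) (at \<tau>) \<and> y \<le> 0"
      by blast
  qed simp
  then show ?thesis
    by (simp add: \<phi>_def Y_def)
qed

section \<open>Decay from a linear differential inequality\<close>

text \<open>Gronwall's argument: the integrating factor \<open>exp (k * u)\<close> turns the
  differential inequality into monotonicity of \<open>\<phi>\<close>.\<close>

lemma exponential_decay:
  fixes E :: "real \<Rightarrow> real"
  assumes deriv: "\<And>t. t \<ge> 0 \<Longrightarrow> (E has_real_derivative E' t) (at t within {0..})"
    and le: "\<And>t. t \<ge> 0 \<Longrightarrow> E' t \<le> - (k * E t)"
    and "0 \<le> t"
  shows "E t \<le> E 0 * exp (- (k * t))"
proof -
  define \<phi> where "\<phi> u = E u * exp (k * u)" for u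
  have d: "(\<phi> has_real_derivative (E' u + k * E u) * exp (k * u)) (at u within {0..})"
    if "u \<ge> 0" for u
    unfolding \<phi>_def
    by (rule derivative_eq_intros deriv that refl)+ (simp add: algebra_simps)
  have "\<phi> t \<le> \<phi> 0"
  \<comment> \<open>At 0 only a one-sided derivative is given, so that endpoint contributes
    continuity alone; inside the interval the derivative is two-sided.\<close>
  proof (rule DERIV_nonpos_imp_decreasing_open[OF \<open>0 \<le> t\<close>])
    fix u assume u: "0 < u" "u < t"
    then have "(\<phi> has_real_derivative (E' u + k * E u) * exp (k * u)) (at u)"
      using d[of u] at_within_interior[of u "{0..}"] by simp
    moreover have "(E' u + k * E u) * exp (k * u) \<le> 0"
      using le[of u] u by (simp add: mult_nonpos_nonneg)
    ultimately show "\<exists>y. (\<phi> has_real_derivative y) (at u) \<and> y \<le> 0"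
      by blast
  next
    have "continuous_on {0..} \<phi>"
      using d by (auto simp: continuous_on_eq_continuous_within intro: DERIV_continuous)
    then show "continuous_on {0..t} \<phi>"
      by (rule continuous_on_subset) auto
  qed
  then have "E t * exp (k * t) * exp (- (k * t)) \<le> E 0 * exp (- (k * t))"
    by (simp add: \<phi>_def)
  then show ?thesis
    by (simp add: mult.assoc flip: exp_add)
qed

section \<open>Pointwise inequalities for the Lyapunov function\<close>

text \<open>The two sides differ by the sum of the squared norms of the pairwise
  differences.\<close>

lemma norm_sum3_squared_le:
  fixes a b c :: "'a::real_inner"
  shows "(norm (a + b + c))\<^sup>2 \<le> 3 * ((norm a)\<^sup>2 + (norm b)\<^sup>2 + (norm c)\<^sup>2)"
proof -
  have "0 \<le> (norm (a - b))\<^sup>2 + (norm (b - c))\<^sup>2 + (norm (a - c))\<^sup>2" by simp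
  then show ?thesis
    unfolding power2_norm_eq_inner by (simp add: algebra_simps inner_commute)
qed

lemma lyapunov_dissipation:
  fixes V Y g h :: "'a::real_inner"
  assumes "r > 0" "q > 0" and c: "c = 1 + r * q" and "V \<bullet> h \<ge> 0"
    and F: "r\<^sup>2 / 2 * (norm Y)\<^sup>2 \<le> F" and Yg: "F + r\<^sup>2 / 2 * (norm Y)\<^sup>2 \<le> Y \<bullet> g"
  shows "- r * (norm V)\<^sup>2 - q / 2 * (V \<bullet> h) - c * r * (Y \<bullet> g) - c * q / 2 * (norm g)\<^sup>2
    \<le> - (r / 4 * (c * F + (norm V)\<^sup>2 / 4 + (norm (V + (2 * r) *\<^sub>R Y + q *\<^sub>R g))\<^sup>2 / 4))"
proof -
  have c1: "c \<ge> 1" and cq: "c \<ge> r * q" using assms by simp_all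
  define W where "W = (norm (V + (2 * r) *\<^sub>R Y + q *\<^sub>R g))\<^sup>2"
  have W: "W \<le> 3 * ((norm V)\<^sup>2 + 4 * r\<^sup>2 * (norm Y)\<^sup>2 + q\<^sup>2 * (norm g)\<^sup>2)"
    using norm_sum3_squared_le[of V "(2 * r) *\<^sub>R Y" "q *\<^sub>R g"]
    by (simp add: W_def power_mult_distrib)
  have rW: "r / 4 * (W / 4) \<le> r / 4 * (3 * ((norm V)\<^sup>2 + 4 * r\<^sup>2 * (norm Y)\<^sup>2 + q\<^sup>2 * (norm g)\<^sup>2) / 4)"
    using W \<open>r > 0\<close> by (intro mult_left_mono divide_right_mono) auto
  have 1: "c * r * (F + r\<^sup>2 / 2 * (norm Y)\<^sup>2) \<le> c * r * (Y \<bullet> g)"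
    using Yg c1 \<open>r > 0\<close> by (intro mult_left_mono) auto
  have 2: "c * r * (r\<^sup>2 / 2 * (norm Y)\<^sup>2) \<le> c * r * F"
    using F c1 \<open>r > 0\<close> by (intro mult_left_mono) auto
  have 3: "r * q * (q * (norm g)\<^sup>2) \<le> c * (q * (norm g)\<^sup>2)"
    using cq \<open>q > 0\<close> by (intro mult_right_mono) auto
  have 4: "1 * (r * (r\<^sup>2 * (norm Y)\<^sup>2)) \<le> c * (r * (r\<^sup>2 * (norm Y)\<^sup>2))"
    using c1 \<open>r > 0\<close> by (intro mult_right_mono) auto
  have "0 \<le> q * (V \<bullet> h)" "0 \<le> r * (norm V)\<^sup>2" "0 \<le> r * q * (q * (norm g)\<^sup>2)"
    "0 \<le> r * (r\<^sup>2 * (norm Y)\<^sup>2)"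
    using assms by simp_all
  \<comment> \<open>The \<open>V\<close> part costs 1/16 + 3/16 of the available \<open>r\<close>;
    the \<open>g\<close> part costs 3/16 of \<open>r * q\<^sup>2\<close>, of which at least 1/2 is
    available. After \<open>r / 4 * (c * F)\<close> is paid, the remaining 3/4 of
    \<open>c * r * F\<close> is worth 3/8 of \<open>c * r * r\<^sup>2 * (norm Y)\<^sup>2\<close>;
    with the 1/2 from fact 1 this exceeds the 3/4 required.\<close>
  with rW 1 2 3 4 show ?thesis
    unfolding W_def[symmetric] by (simp add: algebra_simps power2_eq_square)
qed

text \<open>The prescribed initial velocity turns the coefficient of \<open>g\<close> in the mixed
  vector into a nonpositive number, so its cross term with \<open>Y\<close> helps; all other terms
  are measured in units of \<open>N\<close>.\<close>

lemma lyapunov_initial: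
  fixes V Y g :: "'a::real_inner"
  assumes "r > 0" "q > 0" and c: "c = 1 + r * q" and "r * q \<le> 1"
    and V: "V = - ((2 * q / c) *\<^sub>R g)"
    and F: "F \<le> (norm Y)\<^sup>2 / (2 * q\<^sup>2)" and g: "norm g \<le> norm Y / q\<^sup>2" and Yg: "Y \<bullet> g \<ge> 0"
  shows "c * F + (norm V)\<^sup>2 / 4 + (norm (V + (2 * r) *\<^sub>R Y + q *\<^sub>R g))\<^sup>2 / 4
    \<le> c * (2 * (norm Y)\<^sup>2 / q\<^sup>2)"
proof -
  define \<rho> where "\<rho> = r * q"
  define N where "N = (norm Y)\<^sup>2 / q\<^sup>2"
  have \<rho>: "0 \<le> \<rho>" "\<rho> \<le> 1" "c = 1 + \<rho>" and c1: "c \<ge> 1" and N: "N \<ge> 0"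
    using assms by (auto simp: \<rho>_def N_def)
  have "(norm g)\<^sup>2 \<le> (norm Y / q\<^sup>2)\<^sup>2"
    using g by (intro power_mono) auto
  then have G: "q\<^sup>2 * (norm g)\<^sup>2 \<le> N"
    using \<open>q > 0\<close> unfolding N_def by (simp add: field_simps power2_eq_square)
  have Y: "r\<^sup>2 * (norm Y)\<^sup>2 = \<rho>\<^sup>2 * N"
    using \<open>q > 0\<close> by (simp add: N_def \<rho>_def power_mult_distrib)
  have V2: "(norm V)\<^sup>2 / 4 = q\<^sup>2 * (norm g)\<^sup>2 / c\<^sup>2"
    using c1 by (simp add: V power_mult_distrib power_divide)
  have V2': "(norm V)\<^sup>2 / 4 \<le> N / c\<^sup>2"
    unfolding V2 by (rule divide_right_mono[OF G]) simp
  \<comment> \<open>Since \<open>c = 1 + \<rho>\<close>, the coefficient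
    \<open>q - 2 * q / c\<close> equals \<open>- a\<close>, and \<open>\<rho> \<le> 1\<close> fixes
    its sign.\<close>
  define a where "a = q * (1 - \<rho>) / c"
  have a: "a \<ge> 0" using \<rho> c1 \<open>q > 0\<close> by (simp add: a_def)
  have "V + (2 * r) *\<^sub>R Y + q *\<^sub>R g = (2 * r) *\<^sub>R Y + (q - 2 * q / c) *\<^sub>R g"
    by (simp add: V algebra_simps)
  also have "q - 2 * q / c = - a"
    using \<rho> c1 by (simp add: a_def field_simps)
  finally have W: "V + (2 * r) *\<^sub>R Y + q *\<^sub>R g = (2 * r) *\<^sub>R Y - a *\<^sub>R g"
    by simp
  have "(norm ((2 * r) *\<^sub>R Y - a *\<^sub>R g))\<^sup>2
      = 4 * (r\<^sup>2 * (norm Y)\<^sup>2) + a\<^sup>2 * (norm g)\<^sup>2 - 4 * (r * a * (Y \<bullet> g))"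
    unfolding power2_norm_eq_inner
    by (simp add: algebra_simps inner_commute power2_eq_square)
  also have "\<dots> \<le> 4 * (\<rho>\<^sup>2 * N) + a\<^sup>2 * (norm g)\<^sup>2"
    using Y a Yg \<open>r > 0\<close> by simp
  also have "a\<^sup>2 * (norm g)\<^sup>2 = (1 - \<rho>)\<^sup>2 / c\<^sup>2 * (q\<^sup>2 * (norm g)\<^sup>2)"
    by (simp add: a_def power_mult_distrib power_divide)
  also have "\<dots> \<le> 1 / c\<^sup>2 * N"
    using G \<rho> by (intro mult_mono divide_right_mono) (auto simp: power_le_one)
  finally have W2: "(norm (V + (2 * r) *\<^sub>R Y + q *\<^sub>R g))\<^sup>2 \<le> 4 * (\<rho>\<^sup>2 * N) + N / c\<^sup>2"
    by (simp add: W)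
  have Nc: "N / c\<^sup>2 \<le> N"
    using N c1 by (simp add: divide_le_eq mult_left_le mult_le_cancel_left1)
  have "\<rho>\<^sup>2 \<le> \<rho>" using \<rho> by (simp add: power2_eq_square mult_left_le)
  then have "\<rho>\<^sup>2 * N \<le> \<rho> * N" using N by (rule mult_right_mono)
  moreover have "c * F \<le> c * (N / 2)"
    using F c1 by (intro mult_left_mono) (auto simp: N_def)
  moreover have "0 \<le> \<rho> * N" using \<rho> N by simp
  \<comment> \<open>In units of \<open>N\<close> the three terms are at most \<open>c / 2\<close>, 1
    and \<open>\<rho> + 1 / 4\<close>; their sum \<open>7 / 4 + 3 / 2 * \<rho>\<close> is below
    \<open>2 * c\<close>.\<close>
  ultimately have "c * F + (norm V)\<^sup>2 / 4 + (norm (V + (2 * r) *\<^sub>R Y + q *\<^sub>R g))\<^sup>2 / 4 \<le> c * (2 * N)"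
    using V2' W2 Nc N unfolding \<rho>(3) by (simp add: algebra_simps)
  then show ?thesis by (simp add: N_def)
qed

section \<open>Decay of the objective along a solution of the ODE\<close>

theorem theorem1:
  fixes f :: "real^'n \<Rightarrow> real" and x0 xstar :: "real^'n"
    and X :: "real \<Rightarrow> real^'n" and \<mu> L s t :: real
  assumes "0 < \<mu>" and "\<mu> \<le> L"
    and "f \<in> smooth_strongly_convex2 \<mu> L"
    and "\<And>y. f xstar \<le> f y"
    and "0 < s" and "s \<le> 1 / L"
    and "nag_sc_ode_solution \<mu> s f x0 X"
    and "0 \<le> t"
  shows "f (X t) - f xstar \<le> 2 * (norm (x0 - xstar))\<^sup>2 / s * exp (- (sqrt \<mu> * t / 4))"
proof -
  have diff: "f differentiable (at x)" for x
    using assms(3) unfolding smooth_strongly_convex2_def by blast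
  have lip: "norm (gradient f x - gradient f y) \<le> L * norm (x - y)" for x y
    using assms(3) unfolding smooth_strongly_convex2_def by blast
  have gdiff: "gradient f differentiable (at x)" for x
    using assms(3) unfolding smooth_strongly_convex2_def by blast
  have sc: "f x + gradient f x \<bullet> (y - x) + \<mu> / 2 * (norm (y - x))\<^sup>2 \<le> f y" for x y
    using assms(3) unfolding smooth_strongly_convex2_def by blast
  obtain V A where
    dX: "\<And>t. t \<ge> 0 \<Longrightarrow> (X has_vector_derivative V t) (at t within {0..})" and
    dV: "\<And>t. t \<ge> 0 \<Longrightarrow> (V has_vector_derivative A t) (at t within {0..})" and
    ode: "\<And>t. t \<ge> 0 \<Longrightarrow> A t + (2 * sqrt \<mu>) *\<^sub>R V t + sqrt s *\<^sub>R (hessian f (X t) *v V t)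
      + (1 + sqrt (\<mu> * s)) *\<^sub>R gradient f (X t) = 0" and
    X0: "X 0 = x0" and V0: "V 0 = - ((2 * sqrt s / (1 + sqrt (\<mu> * s))) *\<^sub>R gradient f x0)"
    using assms(7) unfolding nag_sc_ode_solution_def by blast
  define r where "r = sqrt \<mu>"
  define q where "q = sqrt s"
  define c where "c = 1 + r * q"
  have r: "r > 0" "r\<^sup>2 = \<mu>" and q: "q > 0" "q\<^sup>2 = s"
    using assms by (auto simp: r_def q_def)
  have c: "c = 1 + sqrt (\<mu> * s)" and c1: "c \<ge> 1"
    using r q by (simp_all add: c_def r_def q_def real_sqrt_mult)
  have L: "L > 0" "L \<le> 1 / s"
    using assms by (auto simp: field_simps)
  \<comment> \<open>The condition \<open>r * q \<le> 1\<close> supplies the sign needed for the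
    initial value of \<open>E\<close>.\<close>
  have "\<mu> * s \<le> L * s"
    using assms(2,5) by simp
  also have "L * s \<le> 1"
    using L assms(5) by (simp add: field_simps)
  finally have "\<mu> * s \<le> 1" .
  then have rq: "r * q \<le> 1"
    by (simp add: r_def q_def flip: real_sqrt_mult)
  have crit: "gradient f xstar = 0"
    using gradient_eq_0_at_minimum[OF diff] assms(4) .
  \<comment> \<open>Strong convexity is applied in both directions and added, so the function values
    cancel.\<close>
  have mono: "(gradient f x - gradient f y) \<bullet> (x - y) \<ge> 0" for x y
  proof -
    have "gradient f x \<bullet> (y - x) + gradient f y \<bullet> (x - y) + \<mu> * (norm (x - y))\<^sup>2 \<le> 0"
      using sc[of x y] sc[of y x] by (simp add: norm_minus_commute)
    moreover have "0 \<le> \<mu> * (norm (x - y))\<^sup>2" using assms(1) by simp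
    ultimately show ?thesis by (simp add: algebra_simps)
  qed
  have hess: "v \<bullet> (hessian f x *v v) \<ge> 0" for x v
    using monotone_imp_derivative_nonneg[OF has_derivative_hessian[OF gdiff] mono]
    by (simp add: inner_commute)
  define W where "W t = V t + (2 * r) *\<^sub>R (X t - xstar) + q *\<^sub>R gradient f (X t)" for t
  define E where "E t = c * (f (X t) - f xstar) + (norm (V t))\<^sup>2 / 4 + (norm (W t))\<^sup>2 / 4" for t
  define E' where "E' t = - r * (norm (V t))\<^sup>2 - q / 2 * (V t \<bullet> (hessian f (X t) *v V t))
      - c * r * ((X t - xstar) \<bullet> gradient f (X t)) - c * q / 2 * (norm (gradient f (X t)))\<^sup>2" for t
  have dE: "(E has_real_derivative E' t) (at t within {0..})" if t: "t \<ge> 0" for t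
  proof -
    define g where "g = gradient f (X t)"
    define h where "h = hessian f (X t) *v V t"
    have A: "A t = - ((2 * r) *\<^sub>R V t + q *\<^sub>R h + c *\<^sub>R g)"
      using ode[OF t] by (simp add: r_def q_def c g_def h_def add_eq_0_iff add.assoc)
    have dX': "(X has_derivative (\<lambda>u. u *\<^sub>R V t)) (at t within {0..})"
      using dX[OF t] by (simp add: has_vector_derivative_def)
    have "((\<lambda>t. f (X t)) has_real_derivative g \<bullet> V t) (at t within {0..})"
      using has_derivative_compose[OF dX' has_derivative_gradient[OF diff]]
      by (simp add: has_field_derivative_def g_def mult.commute[of _ "_ \<bullet> _"])
    then have dF: "((\<lambda>t. f (X t) - f xstar) has_real_derivative g \<bullet> V t) (at t within {0..})"
      by (auto intro!: derivative_eq_intros)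
    have dg: "((\<lambda>t. gradient f (X t)) has_vector_derivative h) (at t within {0..})"
      using has_derivative_compose[OF dX' has_derivative_hessian[OF gdiff]]
      by (simp add: has_vector_derivative_def h_def matrix_vector_mult_scaleR)
    have "(W has_vector_derivative A t + (2 * r) *\<^sub>R V t + q *\<^sub>R h) (at t within {0..})"
      unfolding W_def
      by (rule derivative_eq_intros dV dX dg t refl)+ simp
    then have dW: "(W has_vector_derivative - (c *\<^sub>R g)) (at t within {0..})"
      by (simp add: A)
    have dsq: "((\<lambda>t. (norm (U t))\<^sup>2) has_real_derivative 2 * (U t \<bullet> D)) (at t within {0..})"
      if "(U has_vector_derivative D) (at t within {0..})" for U and D :: "real^'n"
      using that unfolding has_vector_derivative_def has_field_derivative_def power2_norm_eq_inner
      by (auto intro!: derivative_eq_intros simp: inner_commute algebra_simps)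
    have "(E has_real_derivative c * (g \<bullet> V t) + 2 * (V t \<bullet> A t) / 4 + 2 * (W t \<bullet> - (c *\<^sub>R g)) / 4)
        (at t within {0..})"
      unfolding E_def
      by (intro DERIV_add DERIV_cdivide DERIV_cmult dF dsq[OF dV[OF t]] dsq[OF dW])
    \<comment> \<open>The coefficient of \<open>g \<bullet> V t\<close> is \<open>c\<close> from the
      potential, \<open>- c / 2\<close> from \<open>V t \<bullet> A t\<close> and
      \<open>- c / 2\<close> from \<open>W t\<close>, hence zero.\<close>
    also have "c * (g \<bullet> V t) + 2 * (V t \<bullet> A t) / 4 + 2 * (W t \<bullet> - (c *\<^sub>R g)) / 4 = E' t"
      unfolding E'_def A W_def g_def[symmetric] h_def[symmetric] power2_norm_eq_inner
      by (simp add: inner_simps inner_commute) (simp add: field_simps)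
    finally show ?thesis .
  qed
  have "E' t \<le> - (r / 4 * E t)" for t
    unfolding E_def E'_def W_def
  proof (rule lyapunov_dissipation[OF \<open>r > 0\<close> \<open>q > 0\<close> c_def hess])
    \<comment> \<open>Strong convexity enters twice: expanded at \<open>xstar\<close>, where the
      gradient vanishes, and then expanded at \<open>X t\<close> and evaluated at
      \<open>xstar\<close>.\<close>
    show "r\<^sup>2 / 2 * (norm (X t - xstar))\<^sup>2 \<le> f (X t) - f xstar"
      using sc[of xstar "X t"] by (simp add: crit r)
    show "f (X t) - f xstar + r\<^sup>2 / 2 * (norm (X t - xstar))\<^sup>2 \<le> (X t - xstar) \<bullet> gradient f (X t)"
      using sc[of "X t" xstar]
      by (simp add: r norm_minus_commute inner_commute inner_diff_left inner_diff_right)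
  qed
  then have decay: "E t \<le> E 0 * exp (- (r / 4 * t))"
    using exponential_decay[OF dE] assms(8) by blast
  have "E 0 \<le> c * (2 * (norm (x0 - xstar))\<^sup>2 / q\<^sup>2)"
    unfolding E_def W_def X0
  proof (rule lyapunov_initial[OF \<open>r > 0\<close> \<open>q > 0\<close> c_def rq])
    show "V 0 = - ((2 * q / c) *\<^sub>R gradient f x0)"
      using V0 by (simp add: q_def c)
    have "f x0 - f xstar \<le> L / 2 * (norm (x0 - xstar))\<^sup>2"
      by (rule descent_from_critical_point[OF diff lip crit])
    also have "\<dots> \<le> 1 / s / 2 * (norm (x0 - xstar))\<^sup>2"
      using L by (intro mult_right_mono) auto
    finally show "f x0 - f xstar \<le> (norm (x0 - xstar))\<^sup>2 / (2 * q\<^sup>2)"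
      by (simp add: q mult.commute)
    have "norm (gradient f x0) \<le> L * norm (x0 - xstar)"
      using lip[of x0 xstar] by (simp add: crit)
    also have "\<dots> \<le> 1 / s * norm (x0 - xstar)"
      using L by (intro mult_right_mono) auto
    finally show "norm (gradient f x0) \<le> norm (x0 - xstar) / q\<^sup>2"
      by (simp add: q)
    show "(x0 - xstar) \<bullet> gradient f x0 \<ge> 0"
      using mono[of x0 xstar] by (simp add: crit inner_commute)
  qed
  then have "E 0 * exp (- (r / 4 * t)) \<le> c * (2 * (norm (x0 - xstar))\<^sup>2 / q\<^sup>2) * exp (- (r / 4 * t))"
    by (rule mult_right_mono) simp
  \<comment> \<open>The squares in \<open>E\<close> are dropped; the factor \<open>c\<close> kept in
    the bound on \<open>E 0\<close> now cancels.\<close>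
  moreover have "c * (f (X t) - f xstar) \<le> E t"
    by (simp add: E_def)
  ultimately have "c * (f (X t) - f xstar)
      \<le> c * (2 * (norm (x0 - xstar))\<^sup>2 / s * exp (- (sqrt \<mu> * t / 4)))"
    using decay by (simp add: q r_def mult.assoc)
  then show ?thesis
    by (rule mult_left_le_imp_le) (use c1 in simp)
qed

end
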